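(* Let $\mathbb{F}$ be an algebraically closed field with $\mathrm{Char}(\mathbb{F})\neq 2$, let $L=\mathfrak{sl}_2(\mathbb{F})$, let $N$ be a feasible integer, and let $V=\mathrm{Hom}_N(\mathbb{F}[y,z])$ be the $L$-module of homogeneous polynomials of total degree $N$ in two commuting variables $y,z$. Let $a,a^*$ be normalized semisimple elements of $L$ that generate $L$ as a Lie algebra. Then the ordered pair of linear transformations of $V$ given by the actions of $a$ and $a^*$ on $V$ is a Leonard pair of Krawtchouk type.
   Context: $L=\mathfrak{sl}_2(\mathbb{F})$ is the Lie algebra of trace-zero $2\times 2$ matrices over $\mathbb{F}$ with bracket $[u,v]=uv-vu$, and basis $e=\begin{pmatrix}0&1\\0&0\end{pmatrix}$, $h=\begin{pmatrix}1&0\\0&-1\end{pmatrix}$, $f=\begin{pmatrix}0&0\\1&0\end{pmatrix}$. The bilinear form $\langle u,v\rangle$ on $L$ is $\frac18$ times the Killing form; equivalently $\langle u,v\rangle=\mathrm{tr}(uv)/2$. Write $\|u\|^2=\langle u,u\rangle$. An element $u\in L$ is semisimple if $\mathrm{ad}\,u:L\to L$ is diagonalizable; a semisimple $u$ is normalized if $\|u\|^2=1$. An integer $N$ is feasible if $N\ge 0$ when $\mathrm{Char}(\mathbb{F})=0$, and $0\le N<\mathrm{Char}(\mathbb{F})$ when $\mathrm{Char}(\mathbb{F})>0$. $L$ acts on $\mathbb{F}[y,z]$ by derivations, determined by $e.y=0$, $h.y=y$, $f.y=z$, $e.z=y$, $h.z=-z$, $f.z=0$. The subspace $\mathrm{Hom}_N(\mathbb{F}[y,z])=\mathrm{Span}\{y^{N-i}z^i\}_{i=0}^N$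 is an $L$-submodule. A tridiagonal matrix is irreducible if each subdiagonal entry and each superdiagonal entry is nonzero. A Leonard pair on a vector space $V$ of finite positive dimension is an ordered pair of linear maps $A,A^*:V\to V$ such that (i) there is a basis of $V$ with respect to which the matrix representing $A$ is irreducible tridiagonal and the matrix representing $A^*$ is diagonal; (ii) there is a basis of $V$ with respect to which the matrix representing $A$ is diagonal and the matrix representing $A^*$ is irreducible tridiagonal. Its diameter is $\dim V-1$. For a Leonard pair, an eigenvalue sequence is the sequence of diagonal entries, in order, of the matrix representing $A$ with respect to some basis as in (ii); a dual eigenvalue sequence is the sequence of diagonal entries, in order, of the matrix representing $A^*$ with respect to some basis as in (i). A Leonard pair of diameter $N$ ($N$ feasible) has Krawtchouk type if $\{N-2i\}_{i=0}^N$ is both an eigenvalue sequence and a dual eigenvalue sequence of it. *)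

theory Defs
  imports "HOL-Analysis.Analysis" "HOL-Computational_Algebra.Polynomial"
begin

section \<open>Matrix representations and Leonard pairs\<close>

definition diagonal :: "nat \<Rightarrow> (nat \<Rightarrow> nat \<Rightarrow> 'a::zero) \<Rightarrow> bool" where
  "diagonal n M \<longleftrightarrow> (\<forall>i<n. \<forall>j<n. i \<noteq> j \<longrightarrow> M i j = 0)"

definition irred_tridiagonal :: "nat \<Rightarrow> (nat \<Rightarrow> nat \<Rightarrow> 'a::zero) \<Rightarrow> bool" where
  "irred_tridiagonal n M \<longleftrightarrow>
     (\<forall>i<n. \<forall>j<n. Suc i < j \<or> Suc j < i \<longrightarrow> M i j = 0) \<and>
     (\<forall>i. Suc i < n \<longrightarrow> M (Suc i) i \<noteq> 0 \<and> M i (Suc i) \<noteq> 0)"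

text \<open>For a field of type \<open>'a\<close>; the integers in question are nonnegative, hence \<^typ>\<open>nat\<close>.\<close>

definition feasible :: "'a::field itself \<Rightarrow> nat \<Rightarrow> bool" where
  "feasible _ N \<longleftrightarrow> (CHAR('a) > 0 \<longrightarrow> N < CHAR('a))"

text \<open>A copy of \<^locale>\<open>vector_space\<close>, so that the definitions below are not propagated into the
  existing interpretations of that locale.\<close>

locale leonard_space = vector_space scale
  for scale :: "'a::field \<Rightarrow> 'b::ab_group_add \<Rightarrow> 'b"
begin

definition linear_endo_on :: "'b set \<Rightarrow> ('b \<Rightarrow> 'b) \<Rightarrow> bool" where
  "linear_endo_on V T \<longleftrightarrow>
     (\<forall>x\<in>V. T x \<in> V) \<and>
     (\<forall>x\<in>V. \<forall>y\<in>V. T (x + y) = T x + T y) \<and>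
     (\<forall>c. \<forall>x\<in>V. T (scale c x) = scale c (T x))"

text \<open>An ordered basis is the sequence \<open>b 0, \<dots>, b (dim V - 1)\<close>. Since \<open>dim V = 0\<close> also
  when \<open>V\<close> is infinite-dimensional, this is meaningful for finite-dimensional subspaces only;
  for these, \<open>dim V > 0\<close> means positive dimension.\<close>

definition ordered_basis :: "'b set \<Rightarrow> (nat \<Rightarrow> 'b) \<Rightarrow> bool" where
  "ordered_basis V b \<longleftrightarrow>
     inj_on b {..<dim V} \<and> independent (b ` {..<dim V}) \<and> span (b ` {..<dim V}) = V"

text \<open>Column convention: column \<open>j\<close> holds the coordinates of \<open>T (b j)\<close>.\<close>

definition represents :: "'b set \<Rightarrow> (nat \<Rightarrow> 'b) \<Rightarrow> (nat \<Rightarrow> nat \<Rightarrow> 'a) \<Rightarrow> ('b \<Rightarrow> 'b) \<Rightarrow> bool" where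
  "represents V b M T \<longleftrightarrow> (\<forall>j<dim V. T (b j) = (\<Sum>i<dim V. scale (M i j) (b i)))"

definition diagonalizable_on :: "'b set \<Rightarrow> ('b \<Rightarrow> 'b) \<Rightarrow> bool" where
  "diagonalizable_on V T \<longleftrightarrow>
     linear_endo_on V T \<and>
     (\<exists>b M. ordered_basis V b \<and> represents V b M T \<and> diagonal (dim V) M)"

text \<open>In the basis \<open>b\<close>, the matrix \<open>M\<close> of \<open>A\<close> is diagonal and the matrix \<open>M'\<close> of \<open>B\<close> is
  irreducible tridiagonal: condition (ii) for the pair \<open>A, B\<close>, and condition (i) for \<open>B, A\<close>.\<close>

definition standard_basis ::
    "'b set \<Rightarrow> ('b \<Rightarrow> 'b) \<Rightarrow> ('b \<Rightarrow> 'b) \<Rightarrow> (nat \<Rightarrow> 'b) \<Rightarrow> (nat \<Rightarrow> nat \<Rightarrow> 'a) \<Rightarrow> (nat \<Rightarrow> nat \<Rightarrow> 'a) \<Rightarrow> bool" where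
  "standard_basis V A B b M M' \<longleftrightarrow>
     ordered_basis V b \<and>
     represents V b M A \<and> diagonal (dim V) M \<and>
     represents V b M' B \<and> irred_tridiagonal (dim V) M'"

definition leonard_pair :: "'b set \<Rightarrow> ('b \<Rightarrow> 'b) \<Rightarrow> ('b \<Rightarrow> 'b) \<Rightarrow> bool" where
  "leonard_pair V A A' \<longleftrightarrow>
     subspace V \<and> dim V > 0 \<and> linear_endo_on V A \<and> linear_endo_on V A' \<and>
     (\<exists>b M M'. standard_basis V A' A b M M') \<and>
     (\<exists>b M M'. standard_basis V A A' b M M')"

text \<open>Sequences are indexed by \<open>0, \<dots>, dim V - 1\<close>; later values of \<open>\<theta>\<close> are irrelevant.\<close>

definition eigenvalue_sequence ::
    "'b set \<Rightarrow> ('b \<Rightarrow> 'b) \<Rightarrow> ('b \<Rightarrow> 'b) \<Rightarrow> (nat \<Rightarrow> 'a) \<Rightarrow> bool" where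
  "eigenvalue_sequence V A A' \<theta> \<longleftrightarrow>
     (\<exists>b M M'. standard_basis V A A' b M M' \<and> (\<forall>i<dim V. \<theta> i = M i i))"

definition dual_eigenvalue_sequence ::
    "'b set \<Rightarrow> ('b \<Rightarrow> 'b) \<Rightarrow> ('b \<Rightarrow> 'b) \<Rightarrow> (nat \<Rightarrow> 'a) \<Rightarrow> bool" where
  "dual_eigenvalue_sequence V A A' \<theta> \<longleftrightarrow>
     (\<exists>b M M'. standard_basis V A' A b M M' \<and> (\<forall>i<dim V. \<theta> i = M i i))"

definition krawtchouk_leonard_pair :: "nat \<Rightarrow> 'b set \<Rightarrow> ('b \<Rightarrow> 'b) \<Rightarrow> ('b \<Rightarrow> 'b) \<Rightarrow> bool" where
  "krawtchouk_leonard_pair N V A A' \<longleftrightarrow>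
     leonard_pair V A A' \<and> dim V - 1 = N \<and> feasible TYPE('a) N \<and>
     eigenvalue_sequence V A A' (\<lambda>i. of_nat N - 2 * of_nat i) \<and>
     dual_eigenvalue_sequence V A A' (\<lambda>i. of_nat N - 2 * of_nat i)"

end


section \<open>The Lie algebra of trace-zero matrices\<close>

definition mscale :: "'a::field \<Rightarrow> 'a^2^2 \<Rightarrow> 'a^2^2" where
  "mscale c = map_matrix ((*) c)"

global_interpretation mat2: leonard_space "mscale :: 'a::field \<Rightarrow> 'a^2^2 \<Rightarrow> 'a^2^2"
  by unfold_locales (simp_all add: mscale_def vec_eq_iff algebra_simps)

definition sl2 :: "('a::field^2^2) set" where
  "sl2 = {u. trace u = 0}"

definition bracket :: "'a::field^2^2 \<Rightarrow> 'a^2^2 \<Rightarrow> 'a^2^2" where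
  "bracket u v = u ** v - v ** u"

definition sl2_e :: "'a::field^2^2" where
  "sl2_e = vector [vector [0, 1], vector [0, 0]]"

definition sl2_h :: "'a::field^2^2" where
  "sl2_h = vector [vector [1, 0], vector [0, - 1]]"

definition sl2_f :: "'a::field^2^2" where
  "sl2_f = vector [vector [0, 0], vector [1, 0]]"

text \<open>The trace of \<open>ad u \<circ> ad v\<close> on \<^const>\<open>sl2\<close>, computed in the basis \<open>e, h, f\<close>: the coordinates
  of \<open>w\<close> in this basis are \<open>w $ 1 $ 2\<close>, \<open>w $ 1 $ 1\<close>, \<open>w $ 2 $ 1\<close>.\<close>

definition killing_form :: "'a::field^2^2 \<Rightarrow> 'a^2^2 \<Rightarrow> 'a" where
  "killing_form u v =
     bracket u (bracket v sl2_e) $ 1 $ 2 +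
     bracket u (bracket v sl2_h) $ 1 $ 1 +
     bracket u (bracket v sl2_f) $ 2 $ 1"

definition sl2_form :: "'a::field^2^2 \<Rightarrow> 'a^2^2 \<Rightarrow> 'a" where
  "sl2_form u v = killing_form u v / 8"

definition semisimple :: "'a::field^2^2 \<Rightarrow> bool" where
  "semisimple u \<longleftrightarrow> u \<in> sl2 \<and> mat2.diagonalizable_on sl2 (bracket u)"

definition normalized_semisimple :: "'a::field^2^2 \<Rightarrow> bool" where
  "normalized_semisimple u \<longleftrightarrow> semisimple u \<and> sl2_form u u = 1"

definition lie_subalgebra :: "('a::field^2^2) set \<Rightarrow> bool" where
  "lie_subalgebra K \<longleftrightarrow> K \<subseteq> sl2 \<and> mat2.subspace K \<and> (\<forall>u\<in>K. \<forall>v\<in>K. bracket u v \<in> K)"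

lemma sl2_basis_expansion:
  assumes "u \<in> sl2"
  shows "u = mscale (u $ 1 $ 2) sl2_e + mscale (u $ 1 $ 1) sl2_h + mscale (u $ 2 $ 1) sl2_f"
proof -
  have "u $ 2 $ 2 = - (u $ 1 $ 1)"
    using assms by (simp add: sl2_def trace_def sum_2 eq_neg_iff_add_eq_0 add.commute)
  then show ?thesis
    by (simp add: vec_eq_iff forall_2 mscale_def sl2_e_def sl2_h_def sl2_f_def)
qed

lemma sl2_form_eq_trace:
  fixes u v :: "'a::field^2^2"
  assumes "CHAR('a) \<noteq> 2" "u \<in> sl2" "v \<in> sl2"
  shows "sl2_form u v = trace (u ** v) / 2"
proof -
  have two: "(2::'a) \<noteq> 0"
  proof
    assume "(2::'a) = 0"
    then have "CHAR('a) dvd 2"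
      using of_nat_eq_0_iff_char_dvd[where 'a = 'a, of 2] by simp
    then have "CHAR('a) = 1 \<or> CHAR('a) = 2"
      using prime_nat_iff two_is_prime_nat by blast
    with assms(1) have "CHAR('a) = 1" by simp
    then have "of_nat 1 = (0::'a)" using of_nat_CHAR[where 'a = 'a] by simp
    then show False by simp
  qed
  have d: "u $ 2 $ 2 = - (u $ 1 $ 1)" "v $ 2 $ 2 = - (v $ 1 $ 1)"
    using assms(2,3) by (simp_all add: sl2_def trace_def sum_2 eq_neg_iff_add_eq_0 add.commute)
  have "killing_form u v = 4 * trace (u ** v)"
    by (simp add: killing_form_def bracket_def trace_def matrix_matrix_mult_def sum_2
        sl2_e_def sl2_h_def sl2_f_def d algebra_simps)
  moreover have "(8::'a) = 4 * 2" "(4::'a) = 2 * 2" by simp_all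
  moreover have "(4::'a) \<noteq> 0" using two \<open>(4::'a) = 2 * 2\<close> by (metis mult_eq_0_iff)
  ultimately show ?thesis
    unfolding sl2_form_def by (metis mult_divide_mult_cancel_left)
qed


section \<open>The module of bivariate polynomials\<close>

text \<open>\<open>\<F>[y,z]\<close> is realised as \<open>\<F>[y][z]\<close>.\<close>

type_synonym 'a poly2 = "'a poly poly"

definition pvar_y :: "'a::field poly2" where
  "pvar_y = [:[:0, 1:]:]"

definition pvar_z :: "'a::field poly2" where
  "pvar_z = [:0, 1:]"

definition pscale :: "'a::field \<Rightarrow> 'a poly2 \<Rightarrow> 'a poly2" where
  "pscale c = smult [:c:]"

global_interpretation poly2: leonard_space "pscale :: 'a::field \<Rightarrow> 'a poly2 \<Rightarrow> 'a poly2"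
  by unfold_locales
    (simp_all add: pscale_def smult_add_right smult_add_left[symmetric] mult.commute one_pCons[symmetric])

definition hom_poly :: "nat \<Rightarrow> ('a::field poly2) set" where
  "hom_poly N = poly2.span {pvar_y ^ (N - i) * pvar_z ^ i | i. i \<le> N}"

definition derivation :: "('a::field poly2 \<Rightarrow> 'a poly2) \<Rightarrow> bool" where
  "derivation D \<longleftrightarrow>
     (\<forall>p q. D (p + q) = D p + D q) \<and>
     (\<forall>c p. D (pscale c p) = pscale c (D p)) \<and>
     (\<forall>p q. D (p * q) = D p * q + p * D q)"

text \<open>The derivation sending \<open>y\<close> to \<open>u\<^sub>1\<^sub>1 y + u\<^sub>2\<^sub>1 z\<close> and \<open>z\<close> to \<open>u\<^sub>1\<^sub>2 y + u\<^sub>2\<^sub>2 z\<close>, i.e. the first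
  summand is \<open>(u.y) \<partial>/\<partial>y\<close> and the second \<open>(u.z) \<partial>/\<partial>z\<close>. The lemmas below show that, on \<^const>\<open>sl2\<close>,
  this is the action of the Lie algebra by derivations with the prescribed values on generators.\<close>

definition act :: "'a::field^2^2 \<Rightarrow> 'a poly2 \<Rightarrow> 'a poly2" where
  "act u p =
     (pscale (u $ 1 $ 1) pvar_y + pscale (u $ 2 $ 1) pvar_z) * map_poly pderiv p +
     (pscale (u $ 1 $ 2) pvar_y + pscale (u $ 2 $ 2) pvar_z) * pderiv p"

lemma act_pvar_y: "act u pvar_y = pscale (u $ 1 $ 1) pvar_y + pscale (u $ 2 $ 1) pvar_z"
proof -
  have "map_poly pderiv pvar_y = (1 :: 'a poly2)" "pderiv pvar_y = (0 :: 'a poly2)"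
    by (simp_all add: pvar_y_def map_poly_pCons pderiv_pCons flip: one_pCons)
  then show ?thesis by (simp add: act_def)
qed

lemma act_pvar_z: "act u pvar_z = pscale (u $ 1 $ 2) pvar_y + pscale (u $ 2 $ 2) pvar_z"
proof -
  have "map_poly pderiv pvar_z = (0 :: 'a poly2)" "pderiv pvar_z = (1 :: 'a poly2)"
    by (simp_all add: pvar_z_def map_poly_pCons pderiv_pCons)
  then show ?thesis by (simp add: act_def)
qed

lemma act_generators:
  "act sl2_e pvar_y = 0" "act sl2_h pvar_y = pvar_y" "act sl2_f pvar_y = pvar_z"
  "act sl2_e pvar_z = pvar_y" "act sl2_h pvar_z = - pvar_z" "act sl2_f pvar_z = 0"
  by (simp_all add: act_pvar_y act_pvar_z sl2_e_def sl2_h_def sl2_f_def)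

lemma pderiv_y_add: "map_poly pderiv (p + q) = map_poly pderiv p + map_poly pderiv (q :: 'a::field poly2)"
  by (simp add: poly_eq_iff coeff_map_poly pderiv_add)

lemma pderiv_y_smult:
  "map_poly pderiv (smult c p) = smult (pderiv c) p + smult c (map_poly pderiv (p :: 'a::field poly2))"
  by (rule poly_eqI) (simp add: coeff_map_poly pderiv_mult algebra_simps)

lemma pderiv_y_mult:
  "map_poly pderiv (p * q) = map_poly pderiv p * q + p * map_poly pderiv (q :: 'a::field poly2)"
proof (induction p)
  case (pCons c p)
  then show ?case
    by (simp add: map_poly_pCons pderiv_y_add pderiv_y_smult algebra_simps)
qed simp

lemma derivation_act: "derivation (act u)"
  unfolding derivation_def act_def
  by (auto simp: pderiv_y_add pderiv_add pderiv_y_mult pderiv_mult pscale_def pderiv_y_smult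
      pderiv_smult pderiv_pCons algebra_simps smult_add_right)

lemma derivation_unique:
  fixes D D' :: "'a::field poly2 \<Rightarrow> 'a poly2"
  assumes D: "derivation D" and D': "derivation D'"
    and y: "D pvar_y = D' pvar_y" and z: "D pvar_z = D' pvar_z"
  shows "D = D'"
proof
  have rules: "E (p + q) = E p + E q" "E (pscale c p) = pscale c (E p)"
      "E (p * q) = E p * q + p * E q" if "derivation E" for E :: "'a poly2 \<Rightarrow> 'a poly2" and c p q
    using that unfolding derivation_def by blast+
  have one: "E 1 = 0" if "derivation E" for E :: "'a poly2 \<Rightarrow> 'a poly2"
  proof -
    have "E (1 * 1) = E 1 * 1 + 1 * E 1" using that unfolding derivation_def by blast
    then show ?thesis unfolding mult_1_left mult_1_right by (metis add_cancel_right_right)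
  qed
  have zero: "E 0 = 0" if "derivation E" for E :: "'a poly2 \<Rightarrow> 'a poly2"
  proof -
    have "E (0 + 0) = E 0 + E 0" using that unfolding derivation_def by blast
    then show ?thesis unfolding add_0_left by (metis add_cancel_right_right)
  qed
  have const: "D [:c:] = D' [:c:]" for c
  proof (induction c)
    case 0
    then show ?case using zero[OF D] zero[OF D'] by simp
  next
    case (pCons a c)
    have eq: "[:pCons a c:] = pscale a 1 + pvar_y * [:c:]"
      by (simp add: pscale_def pvar_y_def)
    show ?case
      unfolding eq by (simp only: rules[OF D] rules[OF D'] y pCons.IH one[OF D] one[OF D'])
  qed
  show "D p = D' p" for p
  proof (induction p)
    case 0
    then show ?case using zero[OF D] zero[OF D'] by simp
  next
    case (pCons c p)
    have eq: "pCons c p = [:c:] + pvar_z * p"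
      by (simp add: pvar_z_def)
    show ?case
      unfolding eq by (simp only: rules[OF D] rules[OF D'] z pCons.IH const)
  qed
qed

lemma act_add: "act (u + v) p = act u p + act v p"
  by (simp add: act_def poly2.scale_left_distrib algebra_simps)

lemma act_mscale: "act (mscale c u) p = pscale c (act u p)"
proof -
  have [simp]: "pscale (c * d) q = pscale c (pscale d q)" for d and q :: "'a poly2"
    by simp
  have mult: "pscale c q * r = pscale c (q * r)" for q r :: "'a poly2"
    by (simp add: pscale_def)
  show ?thesis
    by (simp add: act_def mscale_def poly2.scale_right_distrib[symmetric] mult
        del: poly2.scale_scale)
qed

lemma act_bracket: "act (bracket u v) p = act u (act v p) - act v (act u p)"
proof -
  let ?D = "\<lambda>p. act u (act v p) - act v (act u p)"
  have add: "act w (p + q) = act w p + act w q"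
    and scale: "act w (pscale c p) = pscale c (act w p)"
    and mult: "act w (p * q) = act w p * q + p * act w q" for w c p q
    using derivation_act[of w] unfolding derivation_def by blast+
  have "derivation ?D"
    unfolding derivation_def add scale mult
    by (simp add: ring_distribs poly2.scale_right_diff_distrib)
  moreover have "act (bracket u v) pvar_y = ?D pvar_y" "act (bracket u v) pvar_z = ?D pvar_z"
    unfolding add scale act_pvar_y act_pvar_z bracket_def vector_minus_component
      matrix_matrix_mult_def sum_2 vec_lambda_beta poly2.scale_right_distrib
      poly2.scale_left_distrib poly2.scale_left_diff_distrib poly2.scale_scale
    by (simp_all only: mult.commute add_diff_eq diff_add_eq diff_diff_eq diff_diff_eq2
        diff_eq_eq eq_diff_eq add_ac)
  ultimately have "act (bracket u v) = ?D"
    by (intro derivation_unique derivation_act)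
  then show ?thesis by (rule fun_cong)
qed

end

theory Submission
  imports Defs
begin

text \<open>
  A normalized semisimple \<open>a\<close> satisfies \<open>a\<^sup>2 = 1\<close>, so the linear forms have a basis \<open>v, w\<close> with
  \<open>a.v = v\<close> and \<open>a.w = - w\<close>. The products \<open>v\<^sup>N\<^sup>-\<^sup>i w\<^sup>i\<close> form a basis of the module of forms of degree
  \<open>N\<close>, on which \<open>a\<close> is diagonal with entries \<open>N - 2i\<close>. If \<open>a'.v = \<alpha>v + \<beta>w\<close> and
  \<open>a'.w = \<gamma>v + \<delta>w\<close>, the Leibniz rule makes \<open>a'\<close> tridiagonal on this basis, with off-diagonal
  entries \<open>(N - i)\<beta>\<close> and \<open>i\<gamma>\<close>. Here \<open>\<beta>\<close> and \<open>\<gamma>\<close> are nonzero, since otherwise \<open>v\<close> or \<open>w\<close> would be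
  a common eigenvector of the whole Lie algebra, and the integer factors are nonzero by
  feasibility. Exchanging \<open>a\<close> and \<open>a'\<close> gives the other half.
\<close>

section \<open>Bases and the dimension of the module of forms\<close>

text \<open>No set of fewer than \<open>dim V\<close> vectors spans \<open>V\<close>, so a repeated
  or redundant vector among the \<open>dim V\<close> given ones is impossible. This reduces the
  basis property of the products of eigenforms to a spanning statement.\<close>

lemma (in leonard_space) ordered_basis_if_spanning:
  assumes "span (b ` {..<dim V}) = V"
  shows "ordered_basis V b"
proof -
  let ?B = "b ` {..<dim V}"
  have "dim V \<le> card ?B"
    using span_superset[of ?B] by (intro span_card_ge_dim) (simp_all add: assms)
  with card_image_le[of "{..<dim V}" b] have card: "card ?B = dim V"
    by simp
  then have "inj_on b {..<dim V}"
    by (simp add: eq_card_imp_inj_on)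
  moreover have "independent ?B"
  proof
    assume "dependent ?B"
    then obtain x where x: "x \<in> ?B" "x \<in> span (?B - {x})"
      by (auto simp: dependent_def)
    have "span (?B - {x}) = V"
      using x assms span_redundant[OF x(2)] by (simp add: insert_absorb)
    then have "dim V \<le> card (?B - {x})"
      using span_superset[of "?B - {x}"] by (intro span_card_ge_dim) simp_all
    with card x(1) show False
      by (metis card_Diff1_less finite_imageI finite_lessThan not_less)
  qed
  ultimately show ?thesis
    using assms by (simp add: ordered_basis_def)
qed

lemma monomial_eq: "pvar_y ^ m * pvar_z ^ n = monom (monom (1::'a::field) m) n"
proof -
  have "pvar_y ^ m = [:monom (1::'a) m:]"
    by (induction m) (simp_all add: pvar_y_def monom_altdef one_pCons[symmetric])
  moreover have "pvar_z ^ n = monom (1::'a poly) n"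
    by (simp add: pvar_z_def monom_altdef)
  ultimately show ?thesis
    by (simp add: smult_monom)
qed

lemma hom_poly_eq_span: "hom_poly N = poly2.span ((\<lambda>i. pvar_y ^ (N - i) * pvar_z ^ i) ` {..<Suc N})"
  unfolding hom_poly_def by (rule arg_cong[of _ _ poly2.span]) (auto simp: less_Suc_eq_le)

lemma dim_hom_poly: "poly2.dim (hom_poly N :: 'a::field poly2 set) = Suc N"
proof -
  let ?m = "\<lambda>i. pvar_y ^ (N - i) * pvar_z ^ i :: 'a poly2"
  let ?S = "?m ` {..<Suc N}"
  \<comment> \<open>The outer index of a coefficient is the exponent of \<open>z\<close>, the inner
    one that of \<open>y\<close>. These coefficients are dual to the monomials and therefore isolate
    each scalar of a vanishing combination.\<close>
  have coeff: "coeff (coeff (?m i) j) (N - j) = (if i = j then 1 else 0)" for i j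
    by (simp add: monomial_eq)
  have inj: "inj_on ?m {..<Suc N}"
    by (rule inj_onI) (metis coeff zero_neq_one)
  have "poly2.independent ?S"
  proof (rule poly2.independent_if_scalars_zero)
    fix c x assume sum: "(\<Sum>x\<in>?S. pscale (c x) x) = 0" and "x \<in> ?S"
    then obtain j where j: "j < Suc N" "x = ?m j" by auto
    have "0 = coeff (coeff (\<Sum>x\<in>?S. pscale (c x) x) j) (N - j)"
      using sum by simp
    also have "\<dots> = (\<Sum>i<Suc N. c (?m i) * coeff (coeff (?m i) j) (N - j))"
      by (simp add: sum.reindex[OF inj] coeff_sum pscale_def del: sum.lessThan_Suc)
    also have "\<dots> = c x"
      using j by (simp add: coeff sum.delta' if_distrib del: sum.lessThan_Suc cong: if_cong)
    finally show "c x = 0" by simp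
  qed simp
  then have "poly2.dim (poly2.span ?S) = card ?S"
    by (simp add: poly2.dim_eq_card_independent)
  then show ?thesis
    by (simp add: hom_poly_eq_span card_image[OF inj] del: sum.lessThan_Suc)
qed

section \<open>The Leibniz rule on binary forms\<close>

lemma pscale_mult_left: "pscale c p * q = pscale c (p * q)"
  by (simp add: pscale_def)

lemma pscale_mult_right: "p * pscale c q = pscale c (p * q)"
  by (simp add: pscale_def)

lemma of_nat_mult_poly2: "of_nat n * p = pscale (of_nat n) p"
  by (simp add: pscale_def of_nat_poly)

lemma act_linear:
  "act u (p + q) = act u p + act u q" "act u (pscale c p) = pscale c (act u p)"
  "act u (p * q) = act u p * q + p * act u q"
  using derivation_act[of u] unfolding derivation_def by blast+

lemma act_0: "act u 0 = 0" and act_1: "act u 1 = 0"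
proof -
  have "act u (0 + 0) = act u 0 + act u 0" "act u (1 * 1) = act u 1 * 1 + 1 * act u 1"
    by (rule act_linear)+
  then show "act u 0 = 0" "act u 1 = 0"
    unfolding add_0_left mult_1_left mult_1_right by (metis add_cancel_right_right)+
qed

lemma act_power: "act u (p ^ n) = of_nat n * p ^ (n - 1) * act u p"
proof (induction n)
  case 0
  then show ?case by (simp add: act_1)
next
  case (Suc n)
  then show ?case
    \<comment> \<open>Recombining \<open>p * p ^ (n - 1)\<close> into \<open>p ^ n\<close> fails at
      \<open>n = 0\<close>, where subtraction truncates; there the factor \<open>of_nat n\<close>
      vanishes.\<close>
    by (cases n) (simp_all add: act_linear algebra_simps)
qed

definition binary_form :: "'a::field poly2 \<Rightarrow> 'a poly2 \<Rightarrow> nat \<Rightarrow> nat \<Rightarrow> 'a poly2" where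
  "binary_form v w N i = v ^ (N - i) * w ^ i"

text \<open>In the column convention, this is the derivation induced on degree-\<open>N\<close>
  forms by the 2 by 2 matrix with columns (\<alpha>, \<beta>) and (\<gamma>, \<delta>).\<close>

definition action_matrix :: "nat \<Rightarrow> 'a::field \<Rightarrow> 'a \<Rightarrow> 'a \<Rightarrow> 'a \<Rightarrow> nat \<Rightarrow> nat \<Rightarrow> 'a" where
  "action_matrix N \<alpha> \<beta> \<gamma> \<delta> i j =
     (if i = j then of_nat (N - j) * \<alpha> + of_nat j * \<delta>
      else if i = Suc j then of_nat (N - j) * \<beta>
      else if j = Suc i then of_nat j * \<gamma> else 0)"

lemma act_binary_form:
  assumes v: "act u v = pscale \<alpha> v + pscale \<beta> w" and w: "act u w = pscale \<gamma> v + pscale \<delta> w"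
    and j: "j < Suc N"
  shows "act u (binary_form v w N j) =
    (\<Sum>i<Suc N. pscale (action_matrix N \<alpha> \<beta> \<gamma> \<delta> i j) (binary_form v w N i))"
proof -
  \<comment> \<open>The Leibniz rule gives two parts: \<open>up\<close> replaces one factor
    \<open>v\<close> by its image, \<open>down\<close> one factor \<open>w\<close>. At the ends
    \<open>j = N\<close> and \<open>j = 0\<close> the out-of-range neighbour carries the coefficient
    0.\<close>
  let ?b = "binary_form v w N"
  have up: "of_nat (N - j) * v ^ (N - j - 1) * w ^ j * act u v =
      pscale (of_nat (N - j) * \<alpha>) (?b j) +
      (if j < N then pscale (of_nat (N - j) * \<beta>) (?b (Suc j)) else 0)"
  proof (cases "j < N")
    case True
    then obtain k where "N - j = Suc k" "N - Suc j = k" by (metis Suc_diff_Suc)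
    then show ?thesis using True
      by (simp only: v binary_form_def)
        (simp add: of_nat_mult_poly2 pscale_mult_left pscale_mult_right
          poly2.scale_right_distrib algebra_simps del: of_nat_Suc)
  qed (use j in simp)
  have down: "v ^ (N - j) * (of_nat j * w ^ (j - 1) * act u w) =
      pscale (of_nat j * \<delta>) (?b j) +
      (if j > 0 then pscale (of_nat j * \<gamma>) (?b (j - 1)) else 0)"
  proof (cases j)
    case (Suc k)
    then have "N - k = Suc (N - Suc k)" using j by simp
    then show ?thesis using Suc
      by (simp only: w binary_form_def)
        (simp add: of_nat_mult_poly2 pscale_mult_left pscale_mult_right
          poly2.scale_right_distrib algebra_simps del: of_nat_Suc)
  qed simp
  \<comment> \<open>Splitting the column into its three diagonals leaves sums with at most one
    nonzero term. Writing \<open>j = Suc i\<close> as \<open>j > 0 \<and> i = j - 1\<close> puts the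
    condition in the form needed for \<open>sum.delta\<close>.\<close>
  have "(\<Sum>i<Suc N. pscale (action_matrix N \<alpha> \<beta> \<gamma> \<delta> i j) (?b i)) =
    (\<Sum>i<Suc N. (if i = j then pscale (of_nat (N - j) * \<alpha> + of_nat j * \<delta>) (?b i) else 0) +
      (if i = Suc j then pscale (of_nat (N - j) * \<beta>) (?b i) else 0) +
      (if j > 0 \<and> i = j - 1 then pscale (of_nat j * \<gamma>) (?b i) else 0))"
    by (rule sum.cong) (auto simp: action_matrix_def)
  also have "\<dots> = pscale (of_nat (N - j) * \<alpha> + of_nat j * \<delta>) (?b j) +
      (if j < N then pscale (of_nat (N - j) * \<beta>) (?b (Suc j)) else 0) +
      (if j > 0 then pscale (of_nat j * \<gamma>) (?b (j - 1)) else 0)"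
    using j by (cases "j > 0") (simp_all add: sum.distrib sum.delta del: sum.lessThan_Suc)
  also have "\<dots> = act u (?b j)"
    using up down
    by (simp add: binary_form_def act_linear act_power poly2.scale_left_distrib algebra_simps)
  finally show ?thesis by simp
qed

section \<open>Linear forms and change of variables\<close>

text \<open>Coordinates with respect to \<open>y, z\<close> turn the action on linear forms into
  \<open>*v\<close>, so eigenforms can be found among vectors of length two.\<close>

definition linear_form :: "'a::field^2 \<Rightarrow> 'a poly2" where
  "linear_form x = pscale (x $ 1) pvar_y + pscale (x $ 2) pvar_z"

lemma linear_form_add: "linear_form (x + y) = linear_form x + linear_form y"
  by (simp add: linear_form_def poly2.scale_left_distrib algebra_simps)

lemma linear_form_scale: "linear_form (c *s x) = pscale c (linear_form x)"
  by (simp add: linear_form_def poly2.scale_right_distrib)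

lemma act_linear_form: "act u (linear_form x) = linear_form (u *v x)"
  unfolding linear_form_def act_linear act_pvar_y act_pvar_z matrix_vector_mult_def
  by (simp add: sum_2 poly2.scale_left_distrib poly2.scale_right_distrib algebra_simps)

text \<open>Cramer's rule.\<close>

lemma vec2_expansion:
  fixes v w x :: "'a::field^2"
  assumes "v $ 1 * w $ 2 - v $ 2 * w $ 1 \<noteq> 0"
  obtains s t where "x = s *s v + t *s w"
proof
  define D where "D = v $ 1 * w $ 2 - v $ 2 * w $ 1"
  define s t where "s = x $ 1 * w $ 2 - x $ 2 * w $ 1" and "t = v $ 1 * x $ 2 - v $ 2 * x $ 1"
  have "D * x $ 1 = s * v $ 1 + t * w $ 1" "D * x $ 2 = s * v $ 2 + t * w $ 2"
    by (simp_all add: D_def s_def t_def algebra_simps)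
  moreover have "D \<noteq> 0"
    using assms by (simp add: D_def)
  ultimately show "x = (s / D) *s v + (t / D) *s w"
    by (simp add: vec_eq_iff forall_2 add_divide_distrib[symmetric] nonzero_eq_divide_eq mult.commute)
qed

text \<open>A product of \<open>N\<close> linear forms expands in any basis \<open>v, w\<close> of
  linear forms into the products \<open>v^(N-i) w^i\<close>. Applied to the bases
  \<open>y, z\<close> and \<open>v, w\<close> in both directions, this gives the two
  inclusions.\<close>

lemma hom_poly_eq_span_binary_forms:
  fixes v w :: "'a::field^2"
  assumes det: "v $ 1 * w $ 2 - v $ 2 * w $ 1 \<noteq> 0"
  shows "hom_poly N = poly2.span (binary_form (linear_form v) (linear_form w) N ` {..<Suc N})"
proof -
  \<comment> \<open>The vectors are quantified afresh here and in \<open>prod\<close> and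
    \<open>sub\<close>, since these facts are needed both for the given pair and for the coordinate
    axes.\<close>
  have mult: "linear_form x * p \<in> poly2.span (binary_form (linear_form v) (linear_form w) (Suc n) ` {..<Suc (Suc n)})"
    if det: "v $ 1 * w $ 2 - v $ 2 * w $ 1 \<noteq> 0"
      and p: "p \<in> poly2.span (binary_form (linear_form v) (linear_form w) n ` {..<Suc n})"
    for v w x :: "'a^2" and n p
  proof -
    let ?b = "binary_form (linear_form v) (linear_form w)"
    obtain s t where x: "x = s *s v + t *s w" using vec2_expansion[OF det] .
    show ?thesis
      using p
    proof (induction rule: poly2.span_induct_alt)
      case base
      then show ?case by (simp add: poly2.span_zero)
    next
      case (step c q p)
      then obtain i where i: "i < Suc n" "q = ?b n i" by blast
      have "linear_form v * q = ?b (Suc n) i" "linear_form w * q = ?b (Suc n) (Suc i)"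
        using i by (simp_all add: binary_form_def Suc_diff_le)
      then have eq: "linear_form x * q = pscale s (?b (Suc n) i) + pscale t (?b (Suc n) (Suc i))"
        by (simp add: x linear_form_add linear_form_scale pscale_mult_left distrib_right)
      have "linear_form x * q \<in> poly2.span (?b (Suc n) ` {..<Suc (Suc n)})"
        unfolding eq using i(1) by (intro poly2.span_add poly2.span_scale poly2.span_base imageI) simp_all
      then show ?case
        by (simp add: distrib_left pscale_mult_right poly2.span_add poly2.span_scale step.IH)
    qed
  qed
  have prod: "linear_form x ^ m * linear_form y ^ n \<in> poly2.span (binary_form (linear_form v) (linear_form w) (m + n) ` {..<Suc (m + n)})"
    if det: "v $ 1 * w $ 2 - v $ 2 * w $ 1 \<noteq> 0" for v w x y :: "'a^2" and m n
  proof (induction m)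
    case 0
    show ?case
    proof (induction n)
      case 0
      then show ?case by (auto simp: binary_form_def intro!: poly2.span_base)
    next
      case (Suc n)
      then show ?case using mult[OF det] by simp
    qed
  next
    case (Suc m)
    then show ?case using mult[OF det] by (simp add: mult.assoc)
  qed
  have sub: "poly2.span (binary_form (linear_form x) (linear_form y) N ` {..<Suc N}) \<subseteq>
      poly2.span (binary_form (linear_form v) (linear_form w) N ` {..<Suc N})"
    if "v $ 1 * w $ 2 - v $ 2 * w $ 1 \<noteq> 0" for v w x y :: "'a^2"
  proof (rule poly2.span_minimal)
    show "binary_form (linear_form x) (linear_form y) N ` {..<Suc N} \<subseteq>
      poly2.span (binary_form (linear_form v) (linear_form w) N ` {..<Suc N})"
    proof clarify
      fix i assume "i < Suc N"
      then show "binary_form (linear_form x) (linear_form y) N i \<in>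
          poly2.span (binary_form (linear_form v) (linear_form w) N ` {..<Suc N})"
        using prod[OF that, of x "N - i" y i] by (simp add: binary_form_def[of _ _ N i])
    qed
  qed simp
  have "hom_poly N = poly2.span (binary_form (linear_form (axis 1 1)) (linear_form (axis 2 (1::'a))) N ` {..<Suc N})"
    by (simp add: hom_poly_eq_span binary_form_def linear_form_def axis_def del: image_Suc_lessThan)
  then show ?thesis
    using sub[OF det, of "axis 1 1" "axis 2 1"] sub[of "axis 1 1" "axis 2 1" v w]
    by (simp add: axis_def subset_antisym)
qed

lemma linear_endo_act: "poly2.linear_endo_on (hom_poly N) (act u)"
proof -
  \<comment> \<open>With \<open>y, z\<close> as the pair of forms, the coefficients in
    \<open>act_binary_form\<close> are the entries of \<open>u\<close> itself.\<close>
  let ?b = "binary_form pvar_y pvar_z N"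
  have H: "hom_poly N = poly2.span (?b ` {..<Suc N})"
    by (simp add: hom_poly_eq_span binary_form_def)
  have "act u p \<in> hom_poly N" if "p \<in> hom_poly N" for p
    using that unfolding H
  proof (induction rule: poly2.span_induct_alt)
    case base
    then show ?case by (simp add: act_0 poly2.span_zero)
  next
    case (step c q p)
    then obtain j where j: "j < Suc N" "q = ?b j" by blast
    have "act u q \<in> poly2.span (?b ` {..<Suc N})"
      unfolding j(2) act_binary_form[OF act_pvar_y act_pvar_z j(1)]
      by (intro poly2.span_sum poly2.span_scale poly2.span_base imageI)
    then show ?case
      by (simp add: act_linear poly2.span_add poly2.span_scale step.IH)
  qed
  then show ?thesis
    by (simp add: poly2.linear_endo_on_def act_linear)
qed

section \<open>Eigenvectors in the natural two-dimensional module\<close>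

text \<open>The elements having \<open>x\<close> as an eigenvector form a Lie subalgebra. If it
  contains both generators it is all of \<open>sl2\<close>, but \<open>e\<close> and
  \<open>f\<close> share no nonzero eigenvector.\<close>

lemma no_common_eigenvector:
  fixes a a' :: "'a::field^2^2"
  assumes gen: "lie_subalgebra hull {a, a'} = sl2" and sl2: "a \<in> sl2" "a' \<in> sl2"
    and eig: "a *v x = c *s x" "a' *v x = c' *s x"
  shows "x = 0"
proof -
  let ?K = "{u \<in> sl2. \<exists>c. u *v x = c *s x}"
  have "lie_subalgebra ?K"
    unfolding lie_subalgebra_def
  proof (intro conjI ballI)
    show "mat2.subspace ?K"
    proof (rule mat2.subspaceI)
      show "0 \<in> ?K"
        by (auto simp: sl2_def trace_def matrix_vector_mult_def vec_eq_iff intro!: exI[of _ 0])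
    next
      fix u v assume "u \<in> ?K" "v \<in> ?K"
      then obtain d d' where uv: "trace u = 0" "trace v = 0" "u *v x = d *s x" "v *v x = d' *s x"
        by (auto simp: sl2_def)
      have "(u + v) *v x = (d + d') *s x"
        by (simp add: matrix_vector_mult_add_rdistrib uv vector_sadd_rdistrib)
      then have "\<exists>c. (u + v) *v x = c *s x" ..
      then show "u + v \<in> ?K"
        using uv(1,2) by (simp add: sl2_def trace_add)
    next
      fix k u assume "u \<in> ?K"
      then obtain d where u: "trace u = 0" "u *v x = d *s x" by (auto simp: sl2_def)
      have "trace (mscale k u) = k * trace u"
        by (simp add: trace_def mscale_def sum_2 algebra_simps)
      moreover have "mscale k u *v x = k *s (u *v x)"
        by (simp add: vec_eq_iff matrix_vector_mult_def mscale_def sum_2 algebra_simps)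
      ultimately show "mscale k u \<in> ?K"
        using u by (auto simp: sl2_def vector_smult_assoc)
    qed
  next
    fix u v assume "u \<in> ?K" "v \<in> ?K"
    then obtain d d' where uv: "u *v x = d *s x" "v *v x = d' *s x" by auto
    have "trace (bracket u v) = 0"
      by (simp add: bracket_def trace_def matrix_matrix_mult_def sum_2 algebra_simps)
    moreover have "bracket u v *v x = u *v (v *v x) - v *v (u *v x)"
      by (simp add: bracket_def matrix_vector_mult_diff_rdistrib matrix_vector_mul_assoc)
    \<comment> \<open>Both orders of application multiply \<open>x\<close> by
      \<open>d * d'\<close>.\<close>
    then have "bracket u v *v x = 0 *s x"
      by (simp add: uv vector_scalar_commute vec_eq_iff)
    ultimately show "bracket u v \<in> ?K" by (auto simp: sl2_def)
  qed blast
  then have "lie_subalgebra hull {a, a'} \<subseteq> ?K"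
    by (intro hull_minimal) (use sl2 eig in auto)
  then have K: "sl2 \<subseteq> ?K" using gen by simp
  have "sl2_e \<in> ?K" "sl2_f \<in> ?K"
    by (rule subsetD[OF K]; simp add: sl2_def trace_def sum_2 sl2_e_def sl2_f_def)+
  then obtain d d' where "sl2_e *v x = d *s x" "sl2_f *v x = d' *s x" by blast
  then have "x $ 2 = d * x $ 1" "d * x $ 2 = 0" "x $ 1 = d' * x $ 2" "d' * x $ 1 = 0"
    by (auto simp: vec_eq_iff forall_2 matrix_vector_mult_def sum_2 sl2_e_def sl2_f_def)
  then have "x $ 1 = 0" "x $ 2 = 0" by (metis mult_eq_0_iff)+
  then show ?thesis by (simp add: vec_eq_iff forall_2)
qed

lemma two_neq_zero:
  assumes "CHAR('a::field) \<noteq> 2"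
  shows "(2::'a) \<noteq> 0"
proof
  assume "(2::'a) = 0"
  then have "CHAR('a) dvd 2"
    using of_nat_eq_0_iff_char_dvd[where 'a = 'a, of 2] by simp
  then have "CHAR('a) = 1"
    using assms prime_nat_iff two_is_prime_nat by blast
  then show False by simp
qed

text \<open>For trace zero, norm 1 says \<open>p * p + q * r = 1\<close>, that is
  \<open>a\<^sup>2 = 1\<close>. Hence \<open>(a - 1)(a + 1) = 0\<close>: the columns of
  \<open>a + 1\<close> are fixed by \<open>a\<close>, and those of \<open>a - 1\<close> are
  negated.\<close>

lemma normalized_eigenvectors:
  fixes a :: "'a::field^2^2"
  assumes char: "CHAR('a) \<noteq> 2" and a: "normalized_semisimple a"
  obtains v w where "a *v v = v" "a *v w = - w" "v $ 1 * w $ 2 - v $ 2 * w $ 1 \<noteq> 0"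
proof -
  note two = two_neq_zero[OF char]
  have sl2: "a \<in> sl2" and form: "sl2_form a a = 1"
    using a by (auto simp: normalized_semisimple_def semisimple_def)
  define p q r where pqr: "p = a $ 1 $ 1" "q = a $ 1 $ 2" "r = a $ 2 $ 1"
  have s: "a $ 2 $ 2 = - p"
    using sl2 by (simp add: sl2_def trace_def sum_2 pqr eq_neg_iff_add_eq_0 add.commute)
  have "trace (a ** a) = 2 * (p * p + q * r)"
    by (simp add: trace_def matrix_matrix_mult_def sum_2 s algebra_simps flip: pqr)
  then have one: "p * p + q * r = 1"
    using form two by (simp add: sl2_form_eq_trace[OF char sl2 sl2] del: distrib_left_numeral)
  have mv: "(a *v x) $ 1 = p * x $ 1 + q * x $ 2" "(a *v x) $ 2 = r * x $ 1 - p * x $ 2" for x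
    by (simp_all add: matrix_vector_mult_def sum_2 s flip: pqr)
  \<comment> \<open>The first column of \<open>a + 1\<close> is nonzero unless
    \<open>p = -1\<close>; then the second has lower entry 2. The choice of \<open>w\<close> from
    \<open>a - 1\<close> is analogous, with exceptional case \<open>p = 1\<close>.\<close>
  obtain v where v: "a *v v = v" "v \<noteq> 0"
  proof (cases "p = -1")
    case True
    show ?thesis
      by (rule that[of "vector [q, 1 - p]"])
        (use one two True in \<open>simp_all add: vec_eq_iff forall_2 mv algebra_simps\<close>)
  next
    case False
    then show ?thesis
      by (intro that[of "vector [p + 1, r]"])
        (use one in \<open>simp_all add: vec_eq_iff forall_2 mv algebra_simps eq_neg_iff_add_eq_0\<close>)
  qed
  obtain w where w: "a *v w = - w" "w \<noteq> 0"
  proof (cases "p = 1")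
    case True
    show ?thesis
      by (rule that[of "vector [q, - 1 - p]"])
        (use one two True in \<open>simp_all add: vec_eq_iff forall_2 mv algebra_simps\<close>)
  next
    case False
    then show ?thesis
      by (intro that[of "vector [p - 1, r]"])
        (use one in \<open>simp_all add: vec_eq_iff forall_2 mv algebra_simps\<close>)
  qed
  have "v $ 1 * w $ 2 - v $ 2 * w $ 1 \<noteq> 0"
  proof
    assume D: "v $ 1 * w $ 2 - v $ 2 * w $ 1 = 0"
    \<comment> \<open>A zero determinant makes \<open>v\<close> and \<open>w\<close> proportional.
      Applying \<open>a\<close> negates only the right-hand side, so every
      \<open>2 * (w $ i * v $ j)\<close> vanishes.\<close>
    have col: "w $ i *s v = v $ i *s w" for i
      using D exhaust_2[of i] by (auto simp: vec_eq_iff forall_2 algebra_simps)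
    have "w $ i *s (a *v v) = v $ i *s (a *v w)" for i
      using arg_cong[OF col, of "(*v) a"] by (simp add: vector_scalar_commute)
    then have anti: "w $ i *s v = v $ i *s (- w)" for i
      by (simp only: v(1) w(1))
    have zero: "2 * (w $ i * v $ j) = 0" for i j
    proof -
      have "w $ i * v $ j = - (w $ i * v $ j)"
        using arg_cong[OF col[of i], of "\<lambda>x. x $ j"] arg_cong[OF anti[of i], of "\<lambda>x. x $ j"] by simp
      then show ?thesis by (metis add.right_inverse mult_2)
    qed
    have "w $ i = 0 \<or> v $ j = 0" for i j using zero[of i j] two by simp
    then show False using v(2) w(2) by (metis vec_eq_iff zero_index)
  qed
  with v w that show thesis by blast
qed

section \<open>Standard bases and the Leonard pair\<close>

lemma standard_basis_act:
  fixes a a' :: "'a::field^2^2"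
  assumes char: "CHAR('a) \<noteq> 2" and N: "feasible TYPE('a) N"
    and a: "normalized_semisimple a" and a': "a' \<in> sl2"
    and gen: "lie_subalgebra hull {a, a'} = sl2"
  obtains b M M' where "poly2.standard_basis (hom_poly N) (act a) (act a') b M M'"
    "\<And>i. i < Suc N \<Longrightarrow> M i i = of_nat N - 2 * of_nat i"
proof -
  have sl2: "a \<in> sl2" using a by (simp add: normalized_semisimple_def semisimple_def)
  obtain v w where vw: "a *v v = v" "a *v w = - w" and det: "v $ 1 * w $ 2 - v $ 2 * w $ 1 \<noteq> 0"
    using normalized_eigenvectors[OF char a] .
  obtain \<alpha> \<beta> where av: "a' *v v = \<alpha> *s v + \<beta> *s w" using vec2_expansion[OF det] .
  obtain \<gamma> \<delta> where aw: "a' *v w = \<gamma> *s v + \<delta> *s w" using vec2_expansion[OF det] .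
  have eig: "a *v v = 1 *s v" "a *v w = (- 1) *s w"
    using vw by (simp_all add: vec_eq_iff)
  have "\<beta> \<noteq> 0"
    using no_common_eigenvector[OF gen sl2 a' eig(1), of \<alpha>] av det by auto
  moreover have "\<gamma> \<noteq> 0"
    using no_common_eigenvector[OF gen sl2 a' eig(2), of \<delta>] aw det by auto
  \<comment> \<open>A positive characteristic exceeds \<open>N\<close> and cannot divide
    \<open>n\<close>; characteristic 0 divides only 0.\<close>
  moreover have nz: "of_nat n \<noteq> (0::'a)" if "0 < n" "n \<le> N" for n
    using N that by (auto simp: feasible_def of_nat_eq_0_iff_char_dvd dest: dvd_imp_le)
  ultimately have irred: "irred_tridiagonal (Suc N) (action_matrix N \<alpha> \<beta> \<gamma> \<delta>)"
    by (auto simp: irred_tridiagonal_def action_matrix_def simp del: of_nat_Suc of_nat_diff)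
  let ?b = "binary_form (linear_form v) (linear_form w) N"
  \<comment> \<open>The eigenvalues 1 and -1 on \<open>v\<close> and \<open>w\<close> give the
    diagonal entries \<open>(N - i) - i\<close>.\<close>
  let ?M = "action_matrix N 1 0 0 (- 1 :: 'a)"
  have act: "act a (linear_form v) = pscale 1 (linear_form v) + pscale 0 (linear_form w)"
    "act a (linear_form w) = pscale 0 (linear_form v) + pscale (- 1) (linear_form w)"
    "act a' (linear_form v) = pscale \<alpha> (linear_form v) + pscale \<beta> (linear_form w)"
    "act a' (linear_form w) = pscale \<gamma> (linear_form v) + pscale \<delta> (linear_form w)"
    unfolding act_linear_form eig av aw linear_form_add linear_form_scale by simp_all
  show thesis
  proof
    show "poly2.standard_basis (hom_poly N) (act a) (act a') ?b ?M (action_matrix N \<alpha> \<beta> \<gamma> \<delta>)"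
      unfolding poly2.standard_basis_def poly2.represents_def dim_hom_poly
    proof (intro conjI allI impI)
      show "poly2.ordered_basis (hom_poly N) ?b"
        by (rule poly2.ordered_basis_if_spanning)
          (simp only: dim_hom_poly flip: hom_poly_eq_span_binary_forms[OF det])
      show "diagonal (Suc N) ?M"
        by (simp add: diagonal_def action_matrix_def)
    qed (fact irred act_binary_form[OF act(1,2)] act_binary_form[OF act(3,4)])+
    show "?M i i = of_nat N - 2 * of_nat i" if "i < Suc N" for i
      using that by (simp add: action_matrix_def of_nat_diff)
  qed
qed

theorem theorem6p3:
  fixes a a' :: "'a::alg_closed_field^2^2" and N :: nat
  assumes "CHAR('a) \<noteq> 2"
    and "feasible TYPE('a) N"
    and "normalized_semisimple a" and "normalized_semisimple a'"
    and "lie_subalgebra hull {a, a'} = sl2"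
  shows "poly2.krawtchouk_leonard_pair N (hom_poly N) (act a) (act a')"
proof -
  have sl2: "a \<in> sl2" "a' \<in> sl2"
    using assms by (simp_all add: normalized_semisimple_def semisimple_def)
  have gen: "lie_subalgebra hull {a', a} = sl2"
    using assms(5) by (simp add: insert_commute)
  obtain b M M' where 1: "poly2.standard_basis (hom_poly N) (act a) (act a') b M M'"
    "\<And>i. i < Suc N \<Longrightarrow> M i i = of_nat N - 2 * of_nat i"
    by (rule standard_basis_act[OF assms(1,2,3) sl2(2) assms(5)]) blast
  \<comment> \<open>The basis diagonalizing \<open>a'\<close> provides condition (i) and the dual
    eigenvalue sequence.\<close>
  obtain d D D' where 2: "poly2.standard_basis (hom_poly N) (act a') (act a) d D D'"
    "\<And>i. i < Suc N \<Longrightarrow> D i i = of_nat N - 2 * of_nat i"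
    by (rule standard_basis_act[OF assms(1,2,4) sl2(1) gen]) blast
  have "poly2.subspace (hom_poly N :: 'a poly2 set)"
    by (simp add: hom_poly_def)
  with 1(1) 2(1) have "poly2.leonard_pair (hom_poly N) (act a) (act a')"
    unfolding poly2.leonard_pair_def dim_hom_poly by (blast intro: linear_endo_act)
  moreover have "poly2.eigenvalue_sequence (hom_poly N) (act a) (act a') (\<lambda>i. of_nat N - 2 * of_nat i)"
    unfolding poly2.eigenvalue_sequence_def dim_hom_poly using 1 by metis
  moreover have "poly2.dual_eigenvalue_sequence (hom_poly N) (act a) (act a') (\<lambda>i. of_nat N - 2 * of_nat i)"
    unfolding poly2.dual_eigenvalue_sequence_def dim_hom_poly using 2 by metis
  ultimately show ?thesis
    using assms(2) by (simp add: poly2.krawtchouk_leonard_pair_def dim_hom_poly)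
qed

end
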